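(* Let $n$ be a positive integer. The Drazin inverse of $I_{2n}+P_{2n}$ is $$\left(I_{2n}+P_{2n}\right)^{D}=\frac{1}{4n}\sum_{i=0}^{2n-1}(-1)^{i}\,(2n-2i-1)\,P_{2n}^{i}.$$
   Context: Matrices are complex. For a positive integer $N$, matrix indices run over $\{0,1,\dots,N-1\}$ and $P_N$ is the $N\times N$ permutation matrix with $(P_N)_{i,j}=1$ if $j\equiv i+1\pmod N$ and $0$ otherwise; $P_N^0=I_N$. The index of a square matrix $A$ is the smallest non-negative integer $k$ such that $A^k$ and $A^{k+1}$ have the same column space. If $A$ has index $k$, its Drazin inverse $A^D$ is the unique matrix with $AA^D=A^DA$, $A^{k+1}A^D=A^k$ and $A^DAA^D=A^D$. *)

theory Defs
  imports
    "Jordan_Normal_Form.Matrix"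
    "Jordan_Normal_Form.VS_Connect"
    "HOL-Number_Theory.Cong"
    Complex_Main
begin

definition cyclic_perm_mat :: "nat \<Rightarrow> complex mat" where
  "cyclic_perm_mat N = mat N N (\<lambda>(i, j). if [j = i + 1] (mod N) then 1 else 0)"

abbreviation column_space :: "complex mat \<Rightarrow> complex vec set" where
  "column_space A \<equiv> vec_space.col_space (dim_row A) A"

definition mat_index :: "complex mat \<Rightarrow> nat" where
  "mat_index A = (LEAST k. column_space (A ^\<^sub>m k) = column_space (A ^\<^sub>m (k + 1)))"

definition is_drazin_inverse :: "complex mat \<Rightarrow> complex mat \<Rightarrow> bool" where
  "is_drazin_inverse A X \<longleftrightarrow>
     X \<in> carrier_mat (dim_row A) (dim_row A) \<and>
     A * X = X * A \<and>
     A ^\<^sub>m (mat_index A + 1) * X = A ^\<^sub>m mat_index A \<and>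
     X * A * X = X"

(* Meaningful for square matrices only; by drazin_inverse_eqI, the description
   denotes X whenever X satisfies the defining equations. *)
definition drazin_inverse :: "complex mat \<Rightarrow> complex mat" where
  "drazin_inverse A = (THE X. is_drazin_inverse A X)"

(* Type class sums are not available for matrices, since the type of matrices includes all
   dimensions; this is the sum in the ring of N x N matrices. *)
abbreviation mat_sum :: "nat \<Rightarrow> (nat \<Rightarrow> complex mat) \<Rightarrow> nat set \<Rightarrow> complex mat" where
  "mat_sum N f I \<equiv> finsum (ring_mat TYPE(complex) N ()) f I"

lemma (in monoid) drazin_unique:
  assumes a: "a \<in> carrier G" and x: "x \<in> carrier G" and y: "y \<in> carrier G"
    and ax: "a \<otimes> x = x \<otimes> a" and ay: "a \<otimes> y = y \<otimes> a"
    and kx: "a [^] Suc k \<otimes> x = a [^] k" and ky: "a [^] Suc k \<otimes> y = a [^] k"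
    and xx: "x \<otimes> a \<otimes> x = x" and yy: "y \<otimes> a \<otimes> y = y"
  shows "x = y"
proof -
  have left: "z [^] Suc m \<otimes> a [^] m = z" and right: "a [^] m \<otimes> z [^] Suc m = z"
    if z: "z \<in> carrier G" and az: "a \<otimes> z = z \<otimes> a" and zz: "z \<otimes> a \<otimes> z = z" for z and m :: nat
  proof -
    have zpow: "z [^] Suc m \<otimes> a [^] m = z" for m :: nat
    proof (induction m)
      case 0
      then show ?case using z by simp
    next
      case (Suc m)
      have "z [^] Suc (Suc m) \<otimes> a [^] Suc m = z [^] Suc m \<otimes> (z \<otimes> a) \<otimes> a [^] m"
        using z a nat_pow_Suc2[OF a, of m] by (simp add: m_assoc)
      also have "z [^] Suc m \<otimes> (z \<otimes> a) = z [^] m \<otimes> (z \<otimes> a \<otimes> z)"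
        using z a az by (simp add: m_assoc)
      also have "\<dots> = z [^] Suc m" using zz by simp
      finally show ?case using Suc by simp
    qed
    show "z [^] Suc m \<otimes> a [^] m = z" by (rule zpow)
    have "z [^] Suc m \<otimes> a [^] m = a [^] m \<otimes> z [^] Suc m"
      using a z az by (metis group_commutes_pow nat_pow_closed)
    then show "a [^] m \<otimes> z [^] Suc m = z" using zpow by simp
  qed
  have aky: "a [^] k = y \<otimes> a [^] Suc k" if "y \<in> carrier G" "a \<otimes> y = y \<otimes> a"
      "a [^] Suc k \<otimes> y = a [^] k" for y
    using that a group_commutes_pow[of a y "Suc k"] by simp
  have X: "x = x \<otimes> a \<otimes> y"
  proof -
    have "x = x [^] Suc k \<otimes> (a [^] Suc k \<otimes> y)"
      using left[OF x ax xx, of k] ky by simp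
    also have "\<dots> = (x [^] Suc k \<otimes> a [^] k) \<otimes> a \<otimes> y"
      using a x y by (simp add: m_assoc)
    finally show ?thesis using left[OF x ax xx, of k] by simp
  qed
  have "y = a [^] k \<otimes> y [^] Suc k" using right[OF y ay yy] by simp
  also have "\<dots> = x \<otimes> a [^] Suc k \<otimes> y [^] Suc k" using aky[OF x ax kx] by simp
  also have "\<dots> = x \<otimes> a \<otimes> (a [^] k \<otimes> y [^] Suc k)"
    using a x y nat_pow_Suc2[OF a, of k] by (simp add: m_assoc del: nat_pow_Suc)
  also have "\<dots> = x \<otimes> a \<otimes> y" using right[OF y ay yy] by simp
  finally show ?thesis using X by simp
qed

lemma is_drazin_inverse_unique:
  assumes A: "A \<in> carrier_mat N N" and X: "is_drazin_inverse A X" and Y: "is_drazin_inverse A Y"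
  shows "X = Y"
proof -
  interpret R: semiring "ring_mat TYPE(complex) N ()" by (rule semiring_mat)
  have pow: "A ^\<^sub>m k = A [^]\<^bsub>ring_mat TYPE(complex) N ()\<^esub> k" for k
    using A by (rule pow_mat_ring_pow)
  show ?thesis
    by (rule R.drazin_unique[of A X Y "mat_index A"])
      (use A X Y in \<open>auto simp: is_drazin_inverse_def ring_mat_simps pow[symmetric]\<close>)
qed

lemma drazin_inverse_eqI:
  assumes "A \<in> carrier_mat N N" and "is_drazin_inverse A X"
  shows "drazin_inverse A = X"
  unfolding drazin_inverse_def
  using assms is_drazin_inverse_unique by blast

end

theory Submission
  imports Defs
begin

text \<open>Put \<open>N = 2n\<close>, \<open>P = P\<^sub>N\<close>, \<open>A = I + P\<close>, let \<open>X\<close> be the claimed inverse and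
  \<open>T = (\<Sum>i<N. (-1)^i P^i)\<close>. Since \<open>P^N = I\<close> and \<open>N\<close> is even, telescoping gives \<open>A T = 0\<close> and
  \<open>A X = I - T / N\<close>, and \<open>T P = - T\<close> gives \<open>T X = 0\<close> because the numbers \<open>N - 2 i - 1\<close> sum to
  zero. Hence \<open>A X A = A\<close> and \<open>X A X = X\<close>, so \<open>X\<close> is a group inverse of \<open>A\<close> commuting
  with \<open>A\<close>, which is the Drazin inverse whatever the index of \<open>A\<close> is.\<close>

section \<open>Group inverses as Drazin inverses\<close>

lemma col_space_eq_range:
  fixes A :: "'a :: field mat"
  assumes "A \<in> carrier_mat N N"
  shows "vec_space.col_space N A = {A *\<^sub>v x | x. x \<in> carrier_vec N}"
proof -
  interpret vec_space "TYPE('a)" N .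
  show ?thesis unfolding col_space_eq[OF assms] using assms by auto
qed

text \<open>Commutation turns \<open>A * X * A = A\<close> into \<open>A * A * X = A\<close>. For a
  positive index this collapses the two last factors of the power. For index 0 the required equation
  reads \<open>A * X = 1\<^sub>m N\<close>, which follows since \<open>A\<close> is then
  surjective.\<close>

lemma group_inverse_is_drazin_inverse:
  assumes A: "A \<in> carrier_mat N N" and X: "X \<in> carrier_mat N N"
    and AX: "A * X = X * A" and AXA: "A * X * A = A" and XAX: "X * A * X = X"
  shows "is_drazin_inverse A X"
proof -
  have AAX: "A * A * X = A"
    using AXA AX A X by (metis assoc_mult_mat)
  have "A ^\<^sub>m (mat_index A + 1) * X = A ^\<^sub>m mat_index A"
  proof (cases "mat_index A")
    case 0
    \<comment> \<open>The exponent 1 satisfies the condition under \<open>LEAST\<close> in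
      \<open>mat_index\<close>. With such a witness \<open>LeastI\<close> applies, and the least
      exponent, here 0, satisfies it too.\<close>
    have "vec_space.col_space N A = vec_space.col_space N (A * A)"
    proof
      show "vec_space.col_space N A \<subseteq> vec_space.col_space N (A * A)"
      proof
        fix y assume "y \<in> vec_space.col_space N A"
        then obtain x where x: "x \<in> carrier_vec N" and y: "y = A *\<^sub>v x"
          unfolding col_space_eq_range[OF A] by blast
        have "y = (A * A * X) *\<^sub>v x" using y AAX by simp
        also have "\<dots> = (A * A) *\<^sub>v (X *\<^sub>v x)"
          using A X x by (intro assoc_mult_mat_vec) auto
        finally show "y \<in> vec_space.col_space N (A * A)"
          unfolding col_space_eq_range[OF mult_carrier_mat[OF A A]]
          using X x mult_mat_vec_carrier by blast
      qed
      show "vec_space.col_space N (A * A) \<subseteq> vec_space.col_space N A"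
        unfolding col_space_eq_range[OF A] col_space_eq_range[OF mult_carrier_mat[OF A A]]
        using assoc_mult_mat_vec[OF A A] mult_mat_vec_carrier[OF A] by blast
    qed
    then have "column_space (A ^\<^sub>m 1) = column_space (A ^\<^sub>m (1 + 1))"
      using A by simp
    then have "column_space (A ^\<^sub>m mat_index A) = column_space (A ^\<^sub>m (mat_index A + 1))"
      unfolding mat_index_def by (rule LeastI)
    then have space: "vec_space.col_space N (1\<^sub>m N) = vec_space.col_space N A"
      using 0 A by simp
    \<comment> \<open>Every unit vector has the form \<open>A *\<^sub>v x\<close>, and
      \<open>A * X\<close> fixes all such vectors because \<open>A * X * A = A\<close>.\<close>
    have "A * X = 1\<^sub>m N"
    proof (rule eq_matI)
      fix i j assume "i < dim_row (1\<^sub>m N :: complex mat)" "j < dim_col (1\<^sub>m N :: complex mat)"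
      then have ij: "i < N" "j < N" by auto
      have "unit_vec N j \<in> vec_space.col_space N (1\<^sub>m N :: complex mat)"
        unfolding col_space_eq_range[OF one_carrier_mat]
        by (auto intro!: exI[of _ "unit_vec N j"])
      then obtain x where x: "x \<in> carrier_vec N" and e: "unit_vec N j = A *\<^sub>v x"
        unfolding space col_space_eq_range[OF A] by blast
      have "(A * X) *\<^sub>v (A *\<^sub>v x) = (A * X * A) *\<^sub>v x"
        using A X x by (intro assoc_mult_mat_vec[symmetric]) auto
      then have "(A * X) *\<^sub>v unit_vec N j = unit_vec N j"
        by (simp only: e AXA)
      moreover have "(A * X) $$ (i, j) = ((A * X) *\<^sub>v unit_vec N j) $ i"
        using ij A X by (simp add: scalar_prod_right_unit del: assoc_mult_mat_vec row_mult)
      ultimately show "(A * X) $$ (i, j) = 1\<^sub>m N $$ (i, j)"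
        using ij by (simp add: eq_commute)
    qed (use A X in auto)
    then show ?thesis using 0 A by simp
  next
    case (Suc k)
    have "A ^\<^sub>m (mat_index A + 1) * X = A ^\<^sub>m k * (A * A * X)"
      using A X Suc by (simp add: assoc_mult_mat[of _ N N _ N _ N])
    then show ?thesis using AAX Suc by simp
  qed
  then show ?thesis
    using A X AX XAX by (simp add: is_drazin_inverse_def)
qed

section \<open>Weighted sums of matrix powers\<close>

lemma mat_sum_carrier:
  assumes "\<And>i. f i \<in> carrier_mat N N"
  shows "mat_sum N f I \<in> carrier_mat N N"
proof -
  interpret semiring "ring_mat TYPE(complex) N ()" by (rule semiring_mat)
  show ?thesis using finsum_closed[of f I] assms by (auto simp: ring_mat_simps)
qed

lemma mat_sum_empty: "mat_sum N f {..<0::nat} = 0\<^sub>m N N"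
proof -
  interpret semiring "ring_mat TYPE(complex) N ()" by (rule semiring_mat)
  show ?thesis by (simp add: ring_mat_simps)
qed

lemma mat_sum_Suc:
  assumes f: "\<And>i. f i \<in> carrier_mat N N"
  shows "mat_sum N f {..<Suc m} = mat_sum N f {..<m} + f m"
proof -
  interpret semiring "ring_mat TYPE(complex) N ()" by (rule semiring_mat)
  have "mat_sum N f {..<Suc m} = f m + mat_sum N f {..<m}"
    using f by (simp add: lessThan_Suc ring_mat_simps finsum_insert Pi_def)
  then show ?thesis
    using f mat_sum_carrier[of f N] comm_add_mat by metis
qed

lemma pow_mat_Suc_left:
  assumes "P \<in> carrier_mat N N"
  shows "P ^\<^sub>m Suc k = P * P ^\<^sub>m k"
  by (induction k) (use assms in \<open>auto simp: assoc_mult_mat[of _ N N _ N _ N]\<close>)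

text \<open>The number \<open>m\<close> of terms is independent of the dimension \<open>N\<close>,
  so identities can be proved by induction on partial sums.\<close>

definition pow_sum :: "nat \<Rightarrow> (nat \<Rightarrow> complex) \<Rightarrow> complex mat \<Rightarrow> nat \<Rightarrow> complex mat" where
  "pow_sum N c P m = mat_sum N (\<lambda>i. c i \<cdot>\<^sub>m P ^\<^sub>m i) {..<m}"

text \<open>For \<open>N = 2 * n\<close> these are the coefficients of the claimed inverse without
  the common factor \<open>1 / (2 * N)\<close>.\<close>

definition drazin_coeff :: "nat \<Rightarrow> nat \<Rightarrow> complex" where
  "drazin_coeff N i = (- 1) ^ i * (of_nat N - 2 * of_nat i - 1)"

context
  fixes N :: nat and P :: "complex mat"
  assumes P: "P \<in> carrier_mat N N"
begin

lemma pow_sum_carrier [simp]: "pow_sum N c P m \<in> carrier_mat N N"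
  unfolding pow_sum_def using P by (intro mat_sum_carrier) auto

lemma pow_sum_dim [simp]: "dim_row (pow_sum N c P m) = N" "dim_col (pow_sum N c P m) = N"
  using pow_sum_carrier by blast+

lemma pow_sum_0: "pow_sum N c P 0 = 0\<^sub>m N N"
  unfolding pow_sum_def by (rule mat_sum_empty)

lemma pow_sum_Suc: "pow_sum N c P (Suc m) = pow_sum N c P m + c m \<cdot>\<^sub>m P ^\<^sub>m m"
  unfolding pow_sum_def using P by (intro mat_sum_Suc) auto

lemma mult_pow_sum_Suc:
  assumes "Q \<in> carrier_mat N N"
  shows "Q * pow_sum N c P (Suc m) = Q * pow_sum N c P m + c m \<cdot>\<^sub>m (Q * P ^\<^sub>m m)"
  unfolding pow_sum_Suc using assms P
  by (simp add: mult_add_distrib_mat[of _ N N _ N] mult_smult_distrib[of _ N N _ N])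

lemma pow_sum_commute:
  assumes Q: "Q \<in> carrier_mat N N" and "Q * P = P * Q"
  shows "Q * pow_sum N c P m = pow_sum N c P m * Q"
proof (induction m)
  case 0
  then show ?case using Q by (simp add: pow_sum_0)
next
  case (Suc m)
  have "Q * P ^\<^sub>m k = P ^\<^sub>m k * Q" for k
  proof (induction k)
    case (Suc k)
    have "Q * P ^\<^sub>m Suc k = Q * P ^\<^sub>m k * P"
      using P Q by (simp add: assoc_mult_mat[of _ N N _ N _ N])
    also have "\<dots> = P ^\<^sub>m k * (Q * P)"
      using P Q Suc by (simp add: assoc_mult_mat[of _ N N _ N _ N])
    finally show ?case
      using P Q assms(2) by (simp add: assoc_mult_mat[of _ N N _ N _ N])
  qed (use P Q in simp)
  then show ?case
    unfolding mult_pow_sum_Suc[OF Q] Suc.IH unfolding pow_sum_Suc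
    using P Q by (simp add: add_mult_distrib_mat[of _ N N _ _ N] mult_smult_assoc_mat[of _ N N _ N])
qed

text \<open>Multiplication by \<open>1\<^sub>m N + P\<close> adds neighbouring coefficients, which
  cancel; only the two ends survive.\<close>

lemma alternating_pow_sum_telescope:
  "(1\<^sub>m N + P) * pow_sum N (\<lambda>i. (- 1) ^ i) P m = 1\<^sub>m N - (- 1) ^ m \<cdot>\<^sub>m P ^\<^sub>m m"
proof (induction m)
  case 0
  show ?case using P by (auto simp: pow_sum_0 intro!: eq_matI)
next
  case (Suc m)
  have "(1\<^sub>m N + P) * P ^\<^sub>m m = P ^\<^sub>m m + P ^\<^sub>m Suc m"
    using P by (simp add: add_mult_distrib_mat[of _ N N _ _ N] pow_mat_Suc_left[OF P]
        del: pow_mat.simps)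
  then have "(1\<^sub>m N + P) * pow_sum N (\<lambda>i. (- 1) ^ i) P (Suc m) =
      1\<^sub>m N - (- 1) ^ m \<cdot>\<^sub>m P ^\<^sub>m m + (- 1) ^ m \<cdot>\<^sub>m (P ^\<^sub>m m + P ^\<^sub>m Suc m)"
    using P by (simp add: mult_pow_sum_Suc Suc del: pow_mat.simps)
  also have "\<dots> = 1\<^sub>m N - (- 1) ^ Suc m \<cdot>\<^sub>m P ^\<^sub>m Suc m"
    using P by (auto simp: algebra_simps simp del: pow_mat.simps intro!: eq_matI)
  finally show ?case .
qed

text \<open>Neighbouring coefficients \<open>c\<close> of \<open>drazin_coeff\<close> satisfy c_i +
  c_(i-1) = -2 (-1)^i, which gives the multiple of the alternating sum. At i = 0 the coefficient is
  N - 1 = (N + 1) - 2, whence the \<open>of_nat N + 1\<close>; the last term is what c_(m-1) leaves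
  at P^m.\<close>

lemma drazin_pow_sum_telescope:
  "(1\<^sub>m N + P) * pow_sum N (drazin_coeff N) P m =
    (of_nat N + 1) \<cdot>\<^sub>m 1\<^sub>m N - 2 \<cdot>\<^sub>m pow_sum N (\<lambda>i. (- 1) ^ i) P m
      - ((- 1) ^ m * (of_nat N - 2 * of_nat m + 1)) \<cdot>\<^sub>m P ^\<^sub>m m"
proof (induction m)
  case 0
  show ?case using P by (auto simp: pow_sum_0 intro!: eq_matI)
next
  case (Suc m)
  have "(1\<^sub>m N + P) * P ^\<^sub>m m = P ^\<^sub>m m + P ^\<^sub>m Suc m"
    using P by (simp add: add_mult_distrib_mat[of _ N N _ _ N] pow_mat_Suc_left[OF P]
        del: pow_mat.simps)
  then have "(1\<^sub>m N + P) * pow_sum N (drazin_coeff N) P (Suc m) =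
      (of_nat N + 1) \<cdot>\<^sub>m 1\<^sub>m N - 2 \<cdot>\<^sub>m pow_sum N (\<lambda>i. (- 1) ^ i) P m
      - ((- 1) ^ m * (of_nat N - 2 * of_nat m + 1)) \<cdot>\<^sub>m P ^\<^sub>m m
      + drazin_coeff N m \<cdot>\<^sub>m (P ^\<^sub>m m + P ^\<^sub>m Suc m)"
    using P by (simp add: mult_pow_sum_Suc Suc del: pow_mat.simps)
  also have "\<dots> = (of_nat N + 1) \<cdot>\<^sub>m 1\<^sub>m N - 2 \<cdot>\<^sub>m pow_sum N (\<lambda>i. (- 1) ^ i) P (Suc m)
      - ((- 1) ^ Suc m * (of_nat N - 2 * of_nat (Suc m) + 1)) \<cdot>\<^sub>m P ^\<^sub>m Suc m"
    using P by (auto simp: algebra_simps pow_sum_Suc drazin_coeff_def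
        simp del: pow_mat.simps intro!: eq_matI)
  finally show ?case .
qed

text \<open>Since T P^i = (-1)^i T, the signs cancel and \<open>T\<close> is scaled by the sum of N
  - 2i - 1 over i < m, which is m (N - m). It vanishes at m = N.\<close>

lemma mult_drazin_pow_sum:
  assumes T: "T \<in> carrier_mat N N" and TP: "T * P = - T"
  shows "T * pow_sum N (drazin_coeff N) P m = (of_nat m * (of_nat N - of_nat m)) \<cdot>\<^sub>m T"
proof (induction m)
  case 0
  show ?case using T by (auto simp: pow_sum_0 intro!: eq_matI)
next
  case (Suc m)
  have "T * P ^\<^sub>m k = (- 1) ^ k \<cdot>\<^sub>m T" for k
  proof (induction k)
    case 0
    show ?case using T P by (auto intro!: eq_matI)
  next
    case (Suc k)
    have "T * P ^\<^sub>m Suc k = T * P ^\<^sub>m k * P"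
      using T P by (simp add: assoc_mult_mat[of _ N N _ N _ N])
    also have "\<dots> = (- 1) ^ k \<cdot>\<^sub>m (- T)"
      using T P by (simp add: Suc TP mult_smult_assoc_mat[of _ N N _ N])
    finally show ?case using T by (auto intro!: eq_matI)
  qed
  moreover have "drazin_coeff N m * ((- 1) ^ m * t) = (of_nat N - 2 * of_nat m - 1) * t" for t
    by (cases "even m") (simp_all add: drazin_coeff_def algebra_simps)
  ultimately have "T * pow_sum N (drazin_coeff N) P (Suc m) =
      (of_nat m * (of_nat N - of_nat m)) \<cdot>\<^sub>m T + (of_nat N - 2 * of_nat m - 1) \<cdot>\<^sub>m T"
    using T by (auto simp: mult_pow_sum_Suc Suc intro!: eq_matI)
  also have "\<dots> = (of_nat (Suc m) * (of_nat N - of_nat (Suc m))) \<cdot>\<^sub>m T"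
    using T by (auto simp: algebra_simps intro!: eq_matI)
  finally show ?case .
qed

lemma drazin_inverse_one_plus_root:
  assumes N: "N > 0" and "even N" and PN: "P ^\<^sub>m N = 1\<^sub>m N"
  shows "drazin_inverse (1\<^sub>m N + P) = (1 / (2 * of_nat N)) \<cdot>\<^sub>m pow_sum N (drazin_coeff N) P N"
proof -
  define A where "A = 1\<^sub>m N + P"
  define T where "T = pow_sum N (\<lambda>i. (- 1) ^ i) P N"
  define S where "S = pow_sum N (drazin_coeff N) P N"
  let ?X = "(1 / (2 * of_nat N)) \<cdot>\<^sub>m S"
  have carr [simp]: "A \<in> carrier_mat N N" "T \<in> carrier_mat N N" "S \<in> carrier_mat N N"
    using P by (auto simp: A_def T_def S_def)
  have dims [simp]: "dim_row A = N" "dim_col A = N" "dim_row T = N" "dim_col T = N"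
      "dim_row S = N" "dim_col S = N"
    using carr by blast+
  have "A * P = P * A"
    using P by (simp add: A_def add_mult_distrib_mat[of _ N N _ _ N] mult_add_distrib_mat[of _ N N _ N])
  then have AT: "A * T = T * A" and AS: "A * S = S * A"
    unfolding T_def S_def by (intro pow_sum_commute; simp)+
  have "A * T = 0\<^sub>m N N"
    using \<open>even N\<close> unfolding A_def T_def alternating_pow_sum_telescope PN
    by (auto intro!: eq_matI)
  with AT have TA: "T * A = 0\<^sub>m N N" by simp
  have TP: "T * P = - T"
  proof (rule eq_matI)
    fix i j assume ij: "i < dim_row (- T)" "j < dim_col (- T)"
    have "T + T * P = 0\<^sub>m N N"
      using TA P unfolding A_def by (simp add: mult_add_distrib_mat[of _ N N _ N])
    then have "(T + T * P) $$ (i, j) = 0" using ij by simp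
    then show "(T * P) $$ (i, j) = (- T) $$ (i, j)"
      using ij P by (simp add: add_eq_0_iff2)
  qed (use P in auto)
  have TS: "T * S = 0\<^sub>m N N"
    using mult_drazin_pow_sum[OF _ TP, of N] by (auto simp: S_def[symmetric] intro!: eq_matI)
  \<comment> \<open>At m = N the boundary term is -(1 - N) P^N, that is, N - 1 times the identity.
    Together with N + 1 this makes 2N, which explains the normalisation of
    \<open>?X\<close>.\<close>
  have "A * S = (2 * of_nat N) \<cdot>\<^sub>m 1\<^sub>m N - 2 \<cdot>\<^sub>m T"
    unfolding A_def S_def drazin_pow_sum_telescope PN T_def[symmetric] using \<open>even N\<close>
    by (auto intro!: eq_matI)
  then have AX: "A * ?X = 1\<^sub>m N - (1 / of_nat N) \<cdot>\<^sub>m T"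
    using N by (auto simp: mult_smult_distrib[of _ N N _ N] field_simps intro!: eq_matI)
  have XA: "A * ?X = ?X * A"
    using AS by (simp add: mult_smult_distrib[of _ N N _ N] mult_smult_assoc_mat[of _ N N _ N])
  have "A * ?X * A = A"
    unfolding AX using TA
    by (auto simp: minus_mult_distrib_mat[of _ N N _ _ N] mult_smult_assoc_mat[of _ N N _ N]
        intro!: eq_matI)
  \<comment> \<open>Writing \<open>?X * A\<close> as \<open>A * ?X\<close> makes the formula
    \<open>AX\<close> applicable; the term in \<open>T\<close> then dies by
    \<open>TS\<close>.\<close>
  moreover have "?X * A * ?X = ?X"
    unfolding XA[symmetric] AX using TS
    by (auto simp: minus_mult_distrib_mat[of _ N N _ _ N] mult_smult_assoc_mat[of _ N N _ N]
        mult_smult_distrib[of _ N N _ N] intro!: eq_matI)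
  ultimately have "is_drazin_inverse A ?X"
    by (intro group_inverse_is_drazin_inverse[of _ N] XA) auto
  then show ?thesis
    unfolding A_def[symmetric] S_def[symmetric] by (intro drazin_inverse_eqI[of _ N]) auto
qed

end

section \<open>Powers of the cyclic permutation matrix\<close>

lemma cyclic_perm_mat_carrier: "cyclic_perm_mat N \<in> carrier_mat N N"
  by (simp add: cyclic_perm_mat_def)

text \<open>The \<open>k\<close>-th power shifts by \<open>k\<close>: in the inductive step only the
  column (i + k) mod N of row \<open>i\<close> contributes. For \<open>k = N\<close> this yields the
  identity.\<close>

lemma cyclic_perm_mat_pow:
  "cyclic_perm_mat N ^\<^sub>m k = mat N N (\<lambda>(i, j). if [j = i + k] (mod N) then 1 else 0)"
proof (induction k)
  case 0
  show ?case
    by (auto simp: cyclic_perm_mat_def cong_def intro!: eq_matI)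
next
  case (Suc k)
  show ?case
  proof (rule eq_matI, goal_cases)
    case (1 i j)
    then have ij: "i < N" "j < N" by auto
    have "(cyclic_perm_mat N ^\<^sub>m Suc k) $$ (i, j) =
        (\<Sum>l<N. (if [l = i + k] (mod N) then 1 else 0) * (if [j = l + 1] (mod N) then 1 else 0))"
      using ij unfolding pow_mat.simps Suc
      by (simp add: cyclic_perm_mat_def scalar_prod_def atLeast0LessThan)
    also have "\<dots> =
        (\<Sum>l<N. if l = (i + k) mod N then (if [j = l + 1] (mod N) then 1 else 0) else 0)"
      by (intro sum.cong) (auto simp: cong_def)
    also have "\<dots> = (if [j = (i + k) mod N + 1] (mod N) then 1 else 0)"
      using ij by (subst sum.delta) auto
    also have "[j = (i + k) mod N + 1] (mod N) \<longleftrightarrow> [j = i + Suc k] (mod N)"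
      by (simp add: cong_def mod_Suc_eq)
    finally show ?case using ij by simp
  qed (auto simp: cyclic_perm_mat_def)
qed

theorem theorem6p10:
  fixes n :: nat
  assumes "n > 0"
  shows "drazin_inverse (1\<^sub>m (2 * n) + cyclic_perm_mat (2 * n)) =
    (1 / (4 * of_nat n)) \<cdot>\<^sub>m
      mat_sum (2 * n)
        (\<lambda>i. ((- 1) ^ i * of_int (2 * int n - 2 * int i - 1)) \<cdot>\<^sub>m (cyclic_perm_mat (2 * n) ^\<^sub>m i))
        {0..2 * n - 1}"
proof -
  have "cyclic_perm_mat (2 * n) ^\<^sub>m (2 * n) = 1\<^sub>m (2 * n)"
    by (auto simp: cyclic_perm_mat_pow cong_def intro!: eq_matI)
  \<comment> \<open>Positivity of \<open>n\<close> matters here: subtraction on naturals truncates,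
    so for \<open>n = 0\<close> the left side would be {0} and the right side empty.\<close>
  moreover have "{0..2 * n - 1} = {..<2 * n}"
    using assms by auto
  ultimately show ?thesis
    using assms drazin_inverse_one_plus_root[OF cyclic_perm_mat_carrier, of "2 * n"]
    by (simp add: pow_sum_def drazin_coeff_def cyclic_perm_mat_carrier)
qed

end
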